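(* Let $B\ge 1$ be an integer and let $f(B)$ be defined as below. Then $$ f(B) = \begin{cases} \displaystyle 1+ \frac{(a+1)^2}{2\sqrt{a^2+2a}}, & \text{if } B=2a,\ a\in\mathbb{N};\\[2ex] \displaystyle 1+\frac{a^2+3a+2}{\sqrt{4a^2+12a+5}}, & \text{if } B= 2a+1,\ a\in \mathbb{Z}_{\ge 0}. \end{cases} $$
   Context: For an integer $B\ge1$, ${\cal S}_B$ denotes the set of irrational real numbers $\theta=[a_0;a_1,a_2,\ldots]$ (simple continued fraction) with $|a_i|\le B$ for all $i\ge1$. For $\theta$ irrational and an integer $N\ge1$, sort the $N+2$ numbers $0,\{\theta\},\{2\theta\},\ldots,\{N\theta\},1$ (where $\{x\}$ is the fractional part of $x$) as $0=s_0<s_1<\cdots<s_N<s_{N+1}=1$; the gap set is $G(\theta,N)=\{s_{i+1}-s_i: 0\le i\le N\}$ and $H(\theta,N)=\max G(\theta,N)$. Define $f(B)=\sup_{\theta\in{\cal S}_B}\sup_{N\in\mathbb{N}} N\cdot H(\theta,N)$. *)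

theory Defs
  imports "HOL-Analysis.Analysis"
begin

text \<open>
  Simple continued fraction expansion \<open>\<theta> = [a\<^sub>0; a\<^sub>1, a\<^sub>2, \<dots>]\<close> of an irrational number:
  \<open>cf_complete \<theta> n\<close> is the complete quotient \<open>[a\<^sub>n; a\<^sub>n\<^sub>+\<^sub>1, \<dots>]\<close> and \<open>cf_digit \<theta> n\<close> is \<open>a\<^sub>n\<close>.
  For rational \<open>\<theta>\<close> the values are junk once the expansion has terminated.
\<close>

primrec cf_complete :: "real \<Rightarrow> nat \<Rightarrow> real" where
  "cf_complete \<theta> 0 = \<theta>"
| "cf_complete \<theta> (Suc n) = 1 / frac (cf_complete \<theta> n)"

definition cf_digit :: "real \<Rightarrow> nat \<Rightarrow> int" where
  "cf_digit \<theta> n = \<lfloor>cf_complete \<theta> n\<rfloor>"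

lemma cf_complete_irrational:
  assumes "\<theta> \<notin> \<rat>"
  shows "cf_complete \<theta> n \<notin> \<rat>"
proof (induction n)
  case 0
  then show ?case using assms by simp
next
  case (Suc n)
  show ?case
  proof
    assume "cf_complete \<theta> (Suc n) \<in> \<rat>"
    then have "inverse (1 / frac (cf_complete \<theta> n)) \<in> \<rat>"
      unfolding cf_complete.simps by (rule Rats_inverse)
    then have "frac (cf_complete \<theta> n) + of_int \<lfloor>cf_complete \<theta> n\<rfloor> \<in> \<rat>"
      by (intro Rats_add) simp_all
    with Suc show False by (simp add: frac_def)
  qed
qed

lemma cf_complete_rec:
  "cf_complete \<theta> n = of_int (cf_digit \<theta> n) + 1 / cf_complete \<theta> (Suc n)"
  by (simp add: cf_digit_def frac_def)

lemma cf_digit_pos: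
  assumes "\<theta> \<notin> \<rat>" "n \<ge> 1"
  shows "cf_digit \<theta> n \<ge> 1"
proof -
  obtain m where n: "n = Suc m" using assms(2) by (cases n) auto
  have "cf_complete \<theta> m \<notin> \<int>"
    using cf_complete_irrational[OF assms(1), of m] Ints_subset_Rats by blast
  then have "frac (cf_complete \<theta> m) > 0" by (simp add: frac_gt_0_iff)
  moreover have "frac (cf_complete \<theta> m) < 1" by (rule frac_lt_1)
  ultimately show ?thesis by (simp add: n cf_digit_def)
qed

definition bounded_cf :: "nat \<Rightarrow> real set" where
  "bounded_cf B = {\<theta>. \<theta> \<notin> \<rat> \<and> (\<forall>i\<ge>1. \<bar>cf_digit \<theta> i\<bar> \<le> int B)}"

text \<open>
  For irrational \<open>\<theta>\<close> the \<open>N + 2\<close> points below are distinct, so the sorted list is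
  \<open>s\<^sub>0 < \<dots> < s\<^sub>N\<^sub>+\<^sub>1\<close> and all indices used in the gap set are in range.
\<close>

definition sorted_points :: "real \<Rightarrow> nat \<Rightarrow> real list" where
  "sorted_points \<theta> N =
     sorted_list_of_set ({0, 1} \<union> (\<lambda>k. frac (real k * \<theta>)) ` {1..N})"

definition gap_set :: "real \<Rightarrow> nat \<Rightarrow> real set" where
  "gap_set \<theta> N = {sorted_points \<theta> N ! (i + 1) - sorted_points \<theta> N ! i | i. i \<le> N}"

definition max_gap :: "real \<Rightarrow> nat \<Rightarrow> real" where
  "max_gap \<theta> N = Max (gap_set \<theta> N)"

text \<open>The supremum is taken in the extended reals, so that its finiteness is part of any claim
  that it equals a real number.\<close>

definition sup_scaled_gap :: "nat \<Rightarrow> ereal" where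
  "sup_scaled_gap B = (SUP \<theta>\<in>bounded_cf B. SUP N\<in>{1..}. ereal (real N * max_gap \<theta> N))"

end

theory Submission
  imports Defs
begin

text \<open>
  Let \<open>p\<^sub>k / q\<^sub>k\<close> be the convergents of \<open>\<theta>\<close> and \<open>\<eta>\<^sub>k = |q\<^sub>k \<theta> - p\<^sub>k|\<close>. As long as
  \<open>j q\<^sub>k + q\<^sub>k\<^sub>-\<^sub>1 \<le> N + 1 < (j + 1) q\<^sub>k + q\<^sub>k\<^sub>-\<^sub>1\<close> with \<open>1 \<le> j \<le> a\<^sub>k\<^sub>+\<^sub>1\<close>, the largest gap is
  \<open>\<eta>\<^sub>k\<^sub>-\<^sub>1 - (j - 1) \<eta>\<^sub>k\<close>. With \<open>\<alpha> = [a\<^sub>k\<^sub>+\<^sub>1; a\<^sub>k\<^sub>+\<^sub>2, \<dots>]\<close> and \<open>x = q\<^sub>k\<^sub>-\<^sub>1 / q\<^sub>k\<close>, its product with the last such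
  \<open>N\<close> is \<open>(j + 1 + x - 2 / q\<^sub>k) (\<alpha> - j + 1) / (\<alpha> + x)\<close>. For \<open>j + 1 \<le> \<alpha>\<close> the main term is increasing in
  \<open>\<alpha>\<close> and in \<open>x\<close>. The extreme values are \<open>\<alpha> = B + y\<close> and \<open>x = y\<close> with \<open>y = [0; 1, B, 1, B, \<dots>]\<close>; although
  \<open>x\<close> may slightly exceed \<open>y\<close>, the term \<open>2 / q\<^sub>k\<close> compensates for that. Since \<open>B + 2 y = \<surd>(B\<^sup>2 + 4 B)\<close>,
  choosing the integer \<open>j\<close> as close as possible to \<open>B / 2\<close> gives the bound, and it is approached for
  \<open>\<theta> = y\<close>. For \<open>\<alpha> < j + 1\<close> the product is below 2, which is enough unless \<open>B = 1\<close>; then \<open>\<alpha>\<close> is the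
  golden ratio.
\<close>

subsection \<open>Gaps between the points of a rotation\<close>

text \<open>Zero enters as the multiple with \<open>k = 0\<close>, so only the end point 1 has to be
  treated apart from the multiples of \<theta>.\<close>

definition rotation_points :: "real \<Rightarrow> nat \<Rightarrow> real set" where
  "rotation_points \<theta> N = insert 1 ((\<lambda>k. frac (real k * \<theta>)) ` {0..N})"

lemma sorted_points_eq: "sorted_points \<theta> N = sorted_list_of_set (rotation_points \<theta> N)"
proof -
  have "{0..N} = insert 0 {1..N}" by auto
  then show ?thesis
    unfolding sorted_points_def rotation_points_def by (simp add: insert_commute)
qed

lemma finite_rotation_points [simp]: "finite (rotation_points \<theta> N)"
  by (simp add: rotation_points_def)

lemma rotation_points_le_1: "x \<in> rotation_points \<theta> N \<Longrightarrow> x \<le> 1"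
  by (auto simp: rotation_points_def intro: less_imp_le frac_lt_1)

lemma inj_frac_mult:
  assumes "\<theta> \<notin> \<rat>"
  shows "inj (\<lambda>k::nat. frac (real k * \<theta>))"
proof (rule injI, rule ccontr)
  fix k l :: nat
  assume eq: "frac (real k * \<theta>) = frac (real l * \<theta>)" and ne: "k \<noteq> l"
  have "(real k - real l) * \<theta> = of_int (\<lfloor>real k * \<theta>\<rfloor> - \<lfloor>real l * \<theta>\<rfloor>)"
    using eq by (simp add: frac_def algebra_simps)
  then have "\<theta> = of_int (\<lfloor>real k * \<theta>\<rfloor> - \<lfloor>real l * \<theta>\<rfloor>) / (real k - real l)"
    using ne by (simp add: field_simps)
  also have "\<dots> \<in> \<rat>" by (intro Rats_divide Rats_diff Rats_of_int Rats_of_nat)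
  finally show False using assms by simp
qed

lemma card_rotation_points:
  assumes "\<theta> \<notin> \<rat>"
  shows "card (rotation_points \<theta> N) = N + 2"
proof -
  have "1 \<notin> (\<lambda>k. frac (real k * \<theta>)) ` {0..N}"
    using frac_lt_1[where 'a=real] by (force simp: less_le)
  moreover have "card ((\<lambda>k. frac (real k * \<theta>)) ` {0..N}) = N + 1"
    using inj_frac_mult[OF assms] by (subst card_image) (auto intro: inj_on_subset)
  ultimately show ?thesis by (simp add: rotation_points_def)
qed

lemma length_sorted_points:
  assumes "\<theta> \<notin> \<rat>"
  shows "length (sorted_points \<theta> N) = N + 2"
  using card_rotation_points[OF assms] by (simp add: sorted_points_eq)

lemma set_sorted_points [simp]: "set (sorted_points \<theta> N) = rotation_points \<theta> N"
  by (simp add: sorted_points_eq)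

lemma sorted_points_nth_less_iff:
  assumes "i < length (sorted_points \<theta> N)" "j < length (sorted_points \<theta> N)"
  shows "sorted_points \<theta> N ! i < sorted_points \<theta> N ! j \<longleftrightarrow> i < j"
proof -
  have "sorted_wrt (<) (sorted_points \<theta> N)"
    unfolding sorted_points_eq by (rule strict_sorted_list_of_set)
  then show ?thesis
    using assms by (metis less_asym less_irrefl linorder_neqE_nat sorted_wrt_nth_less)
qed

lemma finite_gap_set [simp]: "finite (gap_set \<theta> N)"
  by (simp add: gap_set_def)

text \<open>The left end of a gap is \<open>frac (real n * \<theta>)\<close> for some
  \<open>n \<le> N\<close>. A step of length at most \<open>c\<close> from it hits another point or
  reaches 1, so the next point is at most \<open>c\<close> away.\<close>

lemma max_gap_le:
  assumes irr: "\<theta> \<notin> \<rat>"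
    and step: "\<And>n. n \<le> N \<Longrightarrow> \<exists>m\<le>N. \<exists>s::int. 0 < real m * \<theta> - real n * \<theta> - of_int s \<and>
                 real m * \<theta> - real n * \<theta> - of_int s \<le> c"
  shows "max_gap \<theta> N \<le> c"
  unfolding max_gap_def
proof (rule Max.boundedI)
  show "gap_set \<theta> N \<noteq> {}" by (auto simp: gap_set_def)
next
  let ?s = "sorted_points \<theta> N"
  fix d assume "d \<in> gap_set \<theta> N"
  then obtain i where i: "i \<le> N" and d: "d = ?s ! (i + 1) - ?s ! i"
    by (auto simp: gap_set_def)
  have len: "length ?s = N + 2" by (rule length_sorted_points[OF irr])
  have mem: "?s ! i \<in> rotation_points \<theta> N" "?s ! (i + 1) \<in> rotation_points \<theta> N"
    using i len by (metis add_less_mono1 le_imp_less_Suc nth_mem set_sorted_points Suc_eq_plus1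
        less_Suc_eq add_2_eq_Suc')+
  have "?s ! i < ?s ! (i + 1)"
    using i len by (subst sorted_points_nth_less_iff) auto
  with rotation_points_le_1[OF mem(2)] have "?s ! i < 1" by simp
  with mem(1) obtain n where n: "n \<le> N" "?s ! i = frac (real n * \<theta>)"
    by (auto simp: rotation_points_def)
  obtain m s where m: "m \<le> N" and s: "0 < real m * \<theta> - real n * \<theta> - of_int s"
    "real m * \<theta> - real n * \<theta> - of_int s \<le> c"
    using step[OF n(1)] by blast
  define t where "t = real m * \<theta> - real n * \<theta> - of_int s"
  have "\<exists>x\<in>rotation_points \<theta> N. ?s ! i < x \<and> x \<le> ?s ! i + t"
  proof (cases "?s ! i + t < 1")
    case True
    have "real m * \<theta> - (?s ! i + t) = of_int (s + \<lfloor>real n * \<theta>\<rfloor>)"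
      by (simp add: n t_def frac_def)
    then have "real m * \<theta> - (?s ! i + t) \<in> \<int>" by simp
    moreover have "0 \<le> ?s ! i + t" using s(1) n by (simp add: t_def)
    ultimately have "frac (real m * \<theta>) = ?s ! i + t"
      using True by (simp add: frac_unique_iff)
    then have "?s ! i + t \<in> rotation_points \<theta> N"
      using m by (force simp: rotation_points_def)
    then show ?thesis using s(1) t_def by force
  next
    case False
    then show ?thesis using \<open>?s ! i < 1\<close> by (auto simp: rotation_points_def)
  qed
  then obtain x where x: "x \<in> rotation_points \<theta> N" "?s ! i < x" "x \<le> ?s ! i + t" by blast
  then obtain l where l: "l < length ?s" "?s ! l = x"
    by (metis in_set_conv_nth set_sorted_points)
  then have "i < l" using x i len sorted_points_nth_less_iff[of i \<theta> N l] by simp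
  then have "?s ! (i + 1) \<le> x"
    using l i len sorted_points_nth_less_iff[of l \<theta> N "i + 1"] by simp
  then show "d \<le> c" using x s d by (simp add: t_def)
qed simp

text \<open>The right end of the gap starting at \<open>frac (real n * \<theta>)\<close> is again a
  multiple of \<theta> modulo 1, so \<open>sep\<close> bounds this one gap from below.\<close>

lemma max_gap_ge:
  assumes irr: "\<theta> \<notin> \<rat>" and n: "n \<le> N"
    and sep: "\<And>m (s::int). m \<le> N \<Longrightarrow> 0 < real m * \<theta> - real n * \<theta> - of_int s \<Longrightarrow>
                c \<le> real m * \<theta> - real n * \<theta> - of_int s"
  shows "c \<le> max_gap \<theta> N"
proof -
  let ?s = "sorted_points \<theta> N"
  have len: "length ?s = N + 2" by (rule length_sorted_points[OF irr])
  have "frac (real n * \<theta>) \<in> rotation_points \<theta> N"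
    using n by (auto simp: rotation_points_def)
  then obtain i where i: "i < length ?s" "?s ! i = frac (real n * \<theta>)"
    by (metis in_set_conv_nth set_sorted_points)
  have "1 \<in> rotation_points \<theta> N" by (auto simp: rotation_points_def)
  then obtain l where l: "l < length ?s" "?s ! l = 1"
    by (metis in_set_conv_nth set_sorted_points)
  have "i < l" using i l frac_lt_1[of "real n * \<theta>"] sorted_points_nth_less_iff[of i \<theta> N l] by simp
  then have iN: "i \<le> N" using l len by simp
  then have "?s ! (i + 1) \<in> rotation_points \<theta> N"
    using len nth_mem[of "i + 1" ?s] by simp
  then obtain m k where m: "m \<le> N" "?s ! (i + 1) = real m * \<theta> - of_int k"
  proof -
    assume "?s ! (i + 1) \<in> rotation_points \<theta> N"
    then consider "?s ! (i + 1) = 1"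
      | m where "m \<le> N" "?s ! (i + 1) = frac (real m * \<theta>)"
      by (auto simp: rotation_points_def)
    then show thesis
    proof cases
      case 1
      \<comment> \<open>The end point 1 counts as the multiple with \<open>m = 0\<close>, shifted by
        an integer.\<close>
      then show ?thesis using that[of 0 "-1"] by simp
    next
      case 2
      then show ?thesis using that[of m "\<lfloor>real m * \<theta>\<rfloor>"] by (simp add: frac_def)
    qed
  qed
  let ?d = "?s ! (i + 1) - ?s ! i"
  have eq: "?d = real m * \<theta> - real n * \<theta> - of_int (k - \<lfloor>real n * \<theta>\<rfloor>)"
    unfolding m(2) i(2) frac_def by simp
  have "0 < ?d"
    using iN len sorted_points_nth_less_iff[of i \<theta> N "i + 1"] by simp
  then have "c \<le> ?d"
    using sep[OF m(1), of "k - \<lfloor>real n * \<theta>\<rfloor>"] unfolding eq by blast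
  also have "?d \<le> max_gap \<theta> N"
    unfolding max_gap_def using iN by (intro Max_ge) (auto simp: gap_set_def)
  finally show ?thesis .
qed

section \<open>Gaps governed by one positive and one negative step\<close>

text \<open>From \<open>n\<close> one goes forward by \<open>P\<close> if
  \<open>n + P \<le> N\<close> and back by \<open>Q\<close> otherwise;
  \<open>P + Q \<le> N + 1\<close> yields \<open>Q \<le> n\<close> in the second case.\<close>

lemma max_gap_le_of_two_steps:
  fixes P Q N :: nat and p q :: int
  assumes irr: "\<theta> \<notin> \<rat>"
    and P: "0 < real P * \<theta> - of_int p" and Q: "real Q * \<theta> - of_int q < 0"
    and N: "P + Q \<le> N + 1"
  shows "max_gap \<theta> N \<le> max (real P * \<theta> - of_int p) (of_int q - real Q * \<theta>)"
proof (rule max_gap_le[OF irr])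
  fix n assume n: "n \<le> N"
  show "\<exists>m\<le>N. \<exists>s::int. 0 < real m * \<theta> - real n * \<theta> - of_int s \<and>
          real m * \<theta> - real n * \<theta> - of_int s \<le> max (real P * \<theta> - of_int p) (of_int q - real Q * \<theta>)"
  proof (cases "n + P \<le> N")
    case True
    then show ?thesis
      using P by (intro exI[of _ "n + P"] conjI exI[of _ p]) (auto simp: algebra_simps)
  next
    case False
    with N have "Q \<le> n" by simp
    then show ?thesis
      using Q n by (intro exI[of _ "n - Q"] conjI exI[of _ "- q"]) (auto simp: algebra_simps)
  qed
qed

text \<open>The vectors \<open>(P, p)\<close> and \<open>(Q, q)\<close> form a basis of \<open>\<int>\<^sup>2\<close>. In this basis one sees that no multiple
  \<open>t \<theta>\<close> with \<open>- Q < t < P + Q\<close> lies modulo 1 strictly between 0 and \<open>P \<theta> - p\<close>, so the gap to the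
  right of \<open>(Q - 1) \<theta>\<close> is still unbroken for \<open>N = P + 2 Q - 2\<close>.\<close>

lemma max_gap_ge_of_two_steps:
  fixes P Q N :: nat and p q :: int
  assumes irr: "\<theta> \<notin> \<rat>"
    and P: "0 < real P * \<theta> - of_int p" and Q: "real Q * \<theta> - of_int q < 0" and "0 < Q"
    and det: "int P * q - int Q * p = 1"
    and N: "N + 2 = P + 2 * Q"
  shows "real P * \<theta> - of_int p \<le> max_gap \<theta> N"
proof (rule max_gap_ge[OF irr, of "Q - 1"])
  show "Q - 1 \<le> N" using N \<open>0 < Q\<close> by simp
  fix m and s :: int
  assume m: "m \<le> N" and pos: "0 < real m * \<theta> - real (Q - 1) * \<theta> - of_int s"
  define g h where "g = real P * \<theta> - of_int p" and "h = of_int q - real Q * \<theta>"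
  define t where "t = int m - int (Q - 1)"
  \<comment> \<open>By Cramer's rule with determinant 1, these are the coordinates of
    \<open>(t, s)\<close> in the basis \<open>(P, p)\<close>, \<open>(Q, q)\<close>.\<close>
  define x y where "x = t * q - s * int Q" and "y = s * int P - t * p"
  have t: "- int Q < t" "t < int P + int Q" using m N \<open>0 < Q\<close> by (auto simp: t_def)
  have "x * int P + y * int Q = t * (int P * q - int Q * p)"
    by (simp add: x_def y_def algebra_simps)
  then have t_eq: "t = x * int P + y * int Q" using det by simp
  have "x * p + y * q = s * (int P * q - int Q * p)"
    by (simp add: x_def y_def algebra_simps)
  then have s_eq: "s = x * p + y * q" using det by simp
  have d: "real m * \<theta> - real (Q - 1) * \<theta> - of_int s = of_int t * \<theta> - of_int s"
    by (simp add: t_def algebra_simps)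
  also have "\<dots> = of_int x * g - of_int y * h"
    by (simp add: t_eq s_eq g_def h_def algebra_simps)
  finally have d: "real m * \<theta> - real (Q - 1) * \<theta> - of_int s = of_int x * g - of_int y * h" .
  have gh: "0 < g" "0 < h" using P Q by (auto simp: g_def h_def)
  have "g \<le> of_int x * g - of_int y * h"
  proof (rule ccontr)
    assume less: "\<not> ?thesis"
    show False
    \<comment> \<open>If \<open>x \<ge> 1\<close>, a value below \<open>g\<close> forces
      \<open>y \<ge> 1\<close>, hence \<open>t \<ge> P + Q\<close>. If \<open>x \<le> 0\<close>,
      positivity forces \<open>y \<le> -1\<close>, hence \<open>t \<le> - Q\<close>. Both leave the
      range of \<open>t\<close>.\<close>
    proof (cases "x \<ge> 1")
      case True
      then have "g \<le> of_int x * g" using gh by simp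
      then have "0 < of_int y * h" using less by linarith
      then have "y \<ge> 1" using gh by (simp add: zero_less_mult_iff)
      then have "int P \<le> x * int P" "int Q \<le> y * int Q"
        using True by (simp_all add: mult_le_cancel_right1)
      then show False using t t_eq by simp
    next
      case False
      then have "of_int x * g \<le> 0" using gh by (simp add: mult_le_0_iff)
      then have "of_int y * h < 0" using pos d by linarith
      then have "y \<le> -1" using gh by (simp add: mult_less_0_iff)
      then have "x * int P \<le> 0" "y * int Q \<le> - int Q"
        using False mult_right_mono[of y "-1" "int Q"] by (simp_all add: mult_le_0_iff)
      then show False using t t_eq by simp
    qed
  qed
  then show "real P * \<theta> - of_int p \<le> real m * \<theta> - real (Q - 1) * \<theta> - of_int s"
    unfolding d by (simp add: g_def)
qed

subsection \<open>Convergents and gaps\<close>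

text \<open>Indices are shifted by one against the usual convention: \<open>cf_num \<theta> n\<close> and \<open>cf_den \<theta> n\<close> are
  \<open>p\<^sub>n\<^sub>-\<^sub>1\<close> and \<open>q\<^sub>n\<^sub>-\<^sub>1\<close>.\<close>

fun cf_den :: "real \<Rightarrow> nat \<Rightarrow> nat" where
  "cf_den \<theta> 0 = 0"
| "cf_den \<theta> (Suc 0) = 1"
| "cf_den \<theta> (Suc (Suc n)) = nat (cf_digit \<theta> (Suc n)) * cf_den \<theta> (Suc n) + cf_den \<theta> n"

fun cf_num :: "real \<Rightarrow> nat \<Rightarrow> int" where
  "cf_num \<theta> 0 = 1"
| "cf_num \<theta> (Suc 0) = \<lfloor>\<theta>\<rfloor>"
| "cf_num \<theta> (Suc (Suc n)) = cf_digit \<theta> (Suc n) * cf_num \<theta> (Suc n) + cf_num \<theta> n"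

text \<open>For irrational \<theta> this is the distance between
  \<open>cf_den \<theta> n * \<theta>\<close> and \<open>cf_num \<theta> n\<close>; the product form
  makes its positivity and recurrence immediate.\<close>

definition cf_err :: "real \<Rightarrow> nat \<Rightarrow> real" where
  "cf_err \<theta> n = (\<Prod>i=1..n. 1 / cf_complete \<theta> i)"

declare cf_complete.simps(2) [simp del]

locale irrational =
  fixes \<theta> :: real
  assumes irr: "\<theta> \<notin> \<rat>"
begin

abbreviation "\<alpha> \<equiv> cf_complete \<theta>"
abbreviation "a \<equiv> cf_digit \<theta>"
abbreviation "q \<equiv> cf_den \<theta>"
abbreviation "p \<equiv> cf_num \<theta>"
abbreviation "e \<equiv> cf_err \<theta>"

lemma digit_pos: "a (Suc n) \<ge> 1"
  by (rule cf_digit_pos[OF irr]) simp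

lemma complete_gt_1: "\<alpha> (Suc n) > 1"
proof -
  have "\<alpha> n \<notin> \<int>" using cf_complete_irrational[OF irr, of n] Ints_subset_Rats by blast
  then have "frac (\<alpha> n) > 0" by simp
  moreover have "frac (\<alpha> n) < 1" by (rule frac_lt_1)
  ultimately show ?thesis by (simp add: cf_complete.simps(2))
qed

lemma digit_le_complete: "of_int (a n) \<le> \<alpha> n"
  by (simp add: cf_digit_def)

lemma complete_less_digit: "\<alpha> n < of_int (a n) + 1"
  by (simp add: cf_digit_def)

lemma err_0 [simp]: "e 0 = 1"
  by (simp add: cf_err_def)

lemma err_pos: "e n > 0"
  unfolding cf_err_def
proof (rule prod_pos)
  fix i assume "i \<in> {1..n}"
  then obtain k where "i = Suc k" by (cases i) auto
  then show "0 < 1 / \<alpha> i" using complete_gt_1[of k] by simp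
qed

lemma err_eq: "e n = \<alpha> (Suc n) * e (Suc n)"
  using complete_gt_1[of n] by (simp add: cf_err_def)

lemma err_rec: "e n = of_int (a (Suc n)) * e (Suc n) + e (Suc (Suc n))"
proof -
  have "e (Suc (Suc n)) = e (Suc n) / \<alpha> (Suc (Suc n))"
    using err_eq[of "Suc n"] complete_gt_1[of "Suc n"] by (simp add: field_simps)
  then show ?thesis
    using err_eq[of n] cf_complete_rec[of \<theta> "Suc n"] by (simp add: algebra_simps)
qed

lemma den_rec: "real (q (Suc (Suc n))) = of_int (a (Suc n)) * real (q (Suc n)) + real (q n)"
  using digit_pos[of n] by simp

lemma den_pos: "q (Suc n) > 0"
proof (induction n)
  case (Suc n)
  then show ?case using digit_pos[of n] by simp
qed simp


text \<open>Both sides obey the same two-term recurrence, hence the induction over pairs of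
  consecutive indices.\<close>

lemma den_mult_minus_num:
  "real (q n) * \<theta> - of_int (p n) = (-1) ^ Suc n * e n \<and>
   real (q (Suc n)) * \<theta> - of_int (p (Suc n)) = (-1) ^ n * e (Suc n)"
proof (induction n)
  case 0
  show ?case by (simp add: cf_err_def frac_def cf_complete.simps(2))
next
  case (Suc n)
  have "real (q (Suc (Suc n))) * \<theta> - of_int (p (Suc (Suc n))) =
     of_int (a (Suc n)) * (real (q (Suc n)) * \<theta> - of_int (p (Suc n))) +
     (real (q n) * \<theta> - of_int (p n))"
    unfolding den_rec by (simp add: algebra_simps)
  also have "\<dots> = (-1) ^ n * (of_int (a (Suc n)) * e (Suc n) - e n)"
    unfolding Suc[THEN conjunct1] Suc[THEN conjunct2] by (simp add: algebra_simps)
  also have "\<dots> = (-1) ^ Suc n * e (Suc (Suc n))"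
    using err_rec[of n] by simp
  finally show ?case using Suc by simp
qed

text \<open>Consecutive errors have opposite signs, so each added \<open>q (Suc n)\<close> takes
  \<open>e (Suc n)\<close> off \<open>e n = \<alpha> (Suc n) * e (Suc n)\<close>.\<close>

lemma intermediate_mult_minus_num:
  "real (q n + i * q (Suc n)) * \<theta> - of_int (p n + int i * p (Suc n)) =
   (-1) ^ Suc n * ((\<alpha> (Suc n) - real i) * e (Suc n))"
proof -
  have "real (q n + i * q (Suc n)) * \<theta> - of_int (p n + int i * p (Suc n)) =
      (real (q n) * \<theta> - of_int (p n)) + real i * (real (q (Suc n)) * \<theta> - of_int (p (Suc n)))"
    by (simp add: algebra_simps)
  also have "\<dots> = (-1) ^ Suc n * ((\<alpha> (Suc n) - real i) * e (Suc n))"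
    using den_mult_minus_num[of n] err_eq[of n] by (simp add: algebra_simps)
  finally show ?thesis .
qed

lemma den_num_det: "int (q n) * p (Suc n) - int (q (Suc n)) * p n = (-1) ^ Suc n"
proof (induction n)
  case (Suc n)
  have "int (q (Suc (Suc n))) = a (Suc n) * int (q (Suc n)) + int (q n)"
    using digit_pos[of n] by simp
  then have "int (q (Suc n)) * p (Suc (Suc n)) - int (q (Suc (Suc n))) * p (Suc n) =
     - (int (q n) * p (Suc n) - int (q (Suc n)) * p n)"
    by (simp add: algebra_simps del: cf_den.simps)
  then show ?case using Suc by simp
qed simp

text \<open>The recurrences of \<open>q\<close> and \<open>e\<close> leave this sum invariant. It
  yields the closed form of \<open>e (Suc n)\<close>.\<close>

lemma den_err_eq_1: "real (q (Suc n)) * e n + real (q n) * e (Suc n) = 1"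
proof (induction n)
  case (Suc n)
  then show ?case unfolding den_rec using err_rec[of n] by (simp add: algebra_simps)
qed simp

lemma err_Suc_eq: "e (Suc n) = 1 / (\<alpha> (Suc n) * real (q (Suc n)) + real (q n))"
proof -
  have "e (Suc n) * (\<alpha> (Suc n) * real (q (Suc n)) + real (q n)) = 1"
    using den_err_eq_1[of n] err_eq[of n] by (simp add: algebra_simps)
  then show ?thesis
    by (metis eq_divide_eq mult_zero_right zero_neq_one)
qed

section \<open>Position of N among the denominators and the largest gap\<close>

text \<open>This crude growth bound serves to show that every \<open>N\<close> is eventually
  exceeded and that the denominators of the extremal number tend to infinity.\<close>

lemma den_sum_ge: "n < q (Suc n) + q n"
proof (induction n)
  case (Suc n)
  have "q (Suc n) \<le> nat (a (Suc n)) * q (Suc n)"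
    using digit_pos[of n] mult_le_mono1[of 1 "nat (a (Suc n))" "q (Suc n)"] by linarith
  moreover have "q (Suc (Suc n)) = nat (a (Suc n)) * q (Suc n) + q n" by simp
  ultimately show ?case using Suc den_pos[of n] by linarith
qed simp

text \<open>Take the least \<open>m\<close> with \<open>N + 1 < q (Suc m) + q m\<close>; it is not 0
  because \<open>q 1 + q 0 = 1\<close>. Then \<open>n\<close> is its predecessor, \<open>j\<close>
  is a quotient by \<open>q (Suc n)\<close>, and the choice of \<open>m\<close> bounds
  \<open>j\<close> by the digit.\<close>

lemma obtain_den_bounds:
  obtains n j where "1 \<le> j" "int j \<le> a (Suc n)" "j * q (Suc n) + q n \<le> N + 1"
    "N + 1 < (j + 1) * q (Suc n) + q n"
proof -
  let ?P = "\<lambda>n. N + 1 < q (Suc n) + q n"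
  define m where "m = (LEAST n. ?P n)"
  have "?P (N + 1)" using den_sum_ge[of "N + 1"] .
  then have Pm: "?P m" unfolding m_def by (rule LeastI)
  then have "m \<noteq> 0" by (cases m) auto
  then obtain n where m: "m = Suc n" by (cases m) auto
  then have n: "q (Suc n) + q n \<le> N + 1"
    using not_less_Least[of n ?P] unfolding m_def by simp
  define j where "j = (N + 1 - q n) div q (Suc n)"
  have qpos: "q (Suc n) > 0" by (rule den_pos)
  have j1: "j * q (Suc n) \<le> N + 1 - q n" unfolding j_def by simp
  have j2: "N + 1 - q n < (j + 1) * q (Suc n)"
    unfolding j_def using qpos by (metis Suc_eq_plus1 dividend_less_times_div mult.commute mult_Suc_right)
  have "1 \<le> j"
    unfolding j_def using n qpos by (simp add: Suc_le_eq div_greater_zero_iff)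
  moreover have "int j \<le> a (Suc n)"
  proof -
    have "j * q (Suc n) < (nat (a (Suc n)) + 1) * q (Suc n)"
      using j1 Pm n by (simp add: m)
    then have "j < nat (a (Suc n)) + 1" using mult_less_cancel2 by blast
    then show ?thesis using digit_pos[of n] by simp
  qed
  ultimately show thesis using that[of j n] j1 j2 n by simp
qed

text \<open>The two steps are the intermediate denominator \<open>P\<close> and
  \<open>q (Suc n)\<close>; the parity of \<open>n\<close> decides which one is positive. As
  \<open>j \<le> \<alpha> (Suc n)\<close>, the step by \<open>P\<close> is the longer one.\<close>

lemma max_gap_le_err:
  assumes j: "1 \<le> j" "int j \<le> a (Suc n)" and N: "j * q (Suc n) + q n \<le> N + 1"
  shows "max_gap \<theta> N \<le> (\<alpha> (Suc n) - real j + 1) * e (Suc n)"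
proof -
  define g where "g = (\<alpha> (Suc n) - real j + 1) * e (Suc n)"
  define P where "P = q n + (j - 1) * q (Suc n)"
  define r where "r = p n + int (j - 1) * p (Suc n)"
  have "real j \<le> \<alpha> (Suc n)" using j(2) digit_le_complete[of "Suc n"] by linarith
  then have "e (Suc n) * 1 \<le> e (Suc n) * (\<alpha> (Suc n) - real j + 1)"
    using err_pos[of "Suc n"] by (intro mult_left_mono) auto
  then have gh: "e (Suc n) \<le> g" by (simp add: g_def mult.commute)
  have g0: "0 < g" using gh err_pos[of "Suc n"] by linarith
  have PQ: "P + q (Suc n) \<le> N + 1"
    using N j(1) by (cases j) (auto simp: P_def)
  have P: "real P * \<theta> - of_int r = (-1) ^ Suc n * g"
    unfolding P_def r_def intermediate_mult_minus_num using j(1)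
    by (simp add: g_def of_nat_diff algebra_simps)
  have Q: "real (q (Suc n)) * \<theta> - of_int (p (Suc n)) = (-1) ^ n * e (Suc n)"
    using den_mult_minus_num[of n] by simp
  have "max_gap \<theta> N \<le> max g (e (Suc n))"
  proof (cases "even n")
    case True
    then show ?thesis
      using max_gap_le_of_two_steps[OF irr, of "q (Suc n)" "p (Suc n)" P r N] P Q PQ g0
        err_pos[of "Suc n"] by (simp add: max.commute add.commute)
  next
    case False
    then show ?thesis
      using max_gap_le_of_two_steps[OF irr, of P r "q (Suc n)" "p (Suc n)" N] P Q PQ g0
        err_pos[of "Suc n"] by simp
  qed
  then show ?thesis using gh by (simp add: g_def)
qed

text \<open>The same two steps as in \<open>max_gap_le_err\<close>, for the last \<open>N\<close>
  that belongs to \<open>j\<close>. Odd \<open>n\<close> makes the step by \<open>P\<close> positive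
  and the determinant \<open>+1\<close>.\<close>

lemma max_gap_ge_err:
  assumes j: "1 \<le> j" "int j \<le> a (Suc n)" and N: "N + 2 = (j + 1) * q (Suc n) + q n" and "odd n"
  shows "(\<alpha> (Suc n) - real j + 1) * e (Suc n) \<le> max_gap \<theta> N"
proof -
  define g where "g = (\<alpha> (Suc n) - real j + 1) * e (Suc n)"
  define P where "P = q n + (j - 1) * q (Suc n)"
  define r where "r = p n + int (j - 1) * p (Suc n)"
  have "real j \<le> \<alpha> (Suc n)" using j(2) digit_le_complete[of "Suc n"] by linarith
  then have g0: "0 < g"
    using err_pos[of "Suc n"] by (simp add: g_def)
  have PQ: "N + 2 = P + 2 * q (Suc n)"
    using N j(1) by (cases j) (auto simp: P_def)
  have P: "real P * \<theta> - of_int r = g"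
    unfolding P_def r_def intermediate_mult_minus_num using j(1) \<open>odd n\<close>
    by (simp add: g_def of_nat_diff algebra_simps)
  have Q: "real (q (Suc n)) * \<theta> - of_int (p (Suc n)) = - e (Suc n)"
    using den_mult_minus_num[of n] \<open>odd n\<close> by simp
  have det: "int P * p (Suc n) - int (q (Suc n)) * r = 1"
    using den_num_det[of n] \<open>odd n\<close>
    unfolding P_def r_def by (cases j) (simp_all add: algebra_simps)
  show ?thesis
    using max_gap_ge_of_two_steps[OF irr, of P r "q (Suc n)" "p (Suc n)" N] P Q PQ g0 det
      err_pos[of "Suc n"] den_pos[of n] by (simp add: g_def)
qed

end

subsection \<open>The upper bound\<close>

text \<open>The positive root of \<open>y\<^sup>2 + B y = B\<close> for
  \<open>B \<ge> 1\<close>.\<close>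

definition extremal :: "nat \<Rightarrow> real" where
  "extremal B = (sqrt ((real B)\<^sup>2 + 4 * real B) - real B) / 2"

text \<open>One formula for both parities: \<open>B mod 2\<close> is the least value of
  \<open>(B - 2 j)\<^sup>2\<close> over the integers \<open>j\<close>.\<close>

definition gap_bound :: "nat \<Rightarrow> real" where
  "gap_bound B = 1 + ((real B)\<^sup>2 + 4 * real B + 4 - real (B mod 2)) / (4 * sqrt ((real B)\<^sup>2 + 4 * real B))"

lemma sqrt_eq_extremal: "sqrt ((real B)\<^sup>2 + 4 * real B) = real B + 2 * extremal B"
  by (simp add: extremal_def field_simps)

lemma extremal_quadratic: "(extremal B)\<^sup>2 = real B * (1 - extremal B)"
proof -
  have "(real B + 2 * extremal B)\<^sup>2 = (real B)\<^sup>2 + 4 * real B"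
    unfolding sqrt_eq_extremal[symmetric] by simp
  then show ?thesis by (simp add: power2_eq_square algebra_simps)
qed

lemma extremal_pos:
  assumes "B \<ge> 1"
  shows "0 < extremal B"
proof -
  have "sqrt ((real B)\<^sup>2) < sqrt ((real B)\<^sup>2 + 4 * real B)"
    using assms by (subst real_sqrt_less_iff) simp
  then show ?thesis by (simp add: extremal_def)
qed

lemma extremal_less_1: "extremal B < 1"
proof -
  have "sqrt ((real B)\<^sup>2 + 4 * real B) < sqrt ((real B + 2)\<^sup>2)"
    by (subst real_sqrt_less_iff) (simp add: power2_eq_square algebra_simps)
  then show ?thesis by (simp add: extremal_def)
qed

text \<open>The numerator is symmetric about \<open>x = B / 2\<close>: it equals
  \<open>(B / 2 + 1 + y)\<^sup>2 - (x - B / 2)\<^sup>2\<close> with \<open>y = extremal B\<close>,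
  and the quadratic equation removes \<open>y\<^sup>2\<close>.\<close>

lemma extremal_product_eq:
  assumes "B \<ge> 1"
  shows "(x + 1 + extremal B) * (real B - x + 1 + extremal B) / (real B + 2 * extremal B) =
     1 + ((real B)\<^sup>2 + 4 * real B + 4 - (real B - 2 * x)\<^sup>2) / (4 * (real B + 2 * extremal B))"
proof -
  have S: "0 < real B + 2 * extremal B" using extremal_pos[OF assms] by simp
  have "(x + 1 + extremal B) * (real B - x + 1 + extremal B) =
     (real B + 2 * extremal B) + ((real B)\<^sup>2 + 4 * real B + 4 - (real B - 2 * x)\<^sup>2) / 4"
    using extremal_quadratic[of B] by (simp add: power2_eq_square field_simps)
  then show ?thesis using S by (simp add: add_divide_distrib)
qed

lemma extremal_product_le_gap_bound:
  assumes "B \<ge> 1"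
  shows "(real j + 1 + extremal B) * (real B - real j + 1 + extremal B) / (real B + 2 * extremal B)
           \<le> gap_bound B"
proof -
  have S: "0 < real B + 2 * extremal B" using extremal_pos[OF assms] by simp
  have "real (B mod 2) \<le> (real B - 2 * real j)\<^sup>2"
  proof (cases "even B")
    case False
    then have "int B - 2 * int j \<noteq> 0" by presburger
    then have "1 \<le> (int B - 2 * int j)\<^sup>2" by (smt (verit) zero_less_power2)
    then have "real_of_int 1 \<le> real_of_int ((int B - 2 * int j)\<^sup>2)" by (simp only: of_int_le_iff)
    moreover have "B mod 2 = 1" using False by presburger
    ultimately show ?thesis by simp
  qed simp
  then show ?thesis
    unfolding extremal_product_eq[OF assms] gap_bound_def sqrt_eq_extremal
    using S by (intro add_left_mono divide_right_mono) auto
qed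

text \<open>Half of \<open>B\<close> is rounded up so that the optimal \<open>j\<close> is at least
  1 even for \<open>B = 1\<close>.\<close>

lemma extremal_product_eq_gap_bound:
  assumes "B \<ge> 1"
  shows "(real ((B + 1) div 2) + 1 + extremal B) * (real B - real ((B + 1) div 2) + 1 + extremal B)
           / (real B + 2 * extremal B) = gap_bound B"
proof -
  have "real B - 2 * real ((B + 1) div 2) = - real (B mod 2)"
  proof (cases "even B")
    case True
    then show ?thesis by (elim evenE) simp
  next
    case False
    then show ?thesis by (elim oddE) simp
  qed
  moreover have "(real (B mod 2))\<^sup>2 = real (B mod 2)"
    by (cases "even B") (auto simp: odd_iff_mod_2_eq_one)
  ultimately have "(real B - 2 * real ((B + 1) div 2))\<^sup>2 = real (B mod 2)" by (simp only: power2_minus)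
  then show ?thesis
    unfolding extremal_product_eq[OF assms] gap_bound_def sqrt_eq_extremal by simp
qed

text \<open>With \<open>S\<close> the square root, the claim follows from
  \<open>(S - 1) * (S - 3) \<ge> 0\<close>. For \<open>B = 1\<close> the value is
  \<open>1 + 2 / sqrt 5 < 2\<close>, which is why that case is treated separately.\<close>

lemma gap_bound_ge_2:
  assumes "B \<ge> 2"
  shows "2 \<le> gap_bound B"
proof -
  define S where "S = sqrt ((real B)\<^sup>2 + 4 * real B)"
  have S2: "S\<^sup>2 = (real B)\<^sup>2 + 4 * real B" by (simp add: S_def)
  have "3 \<le> S"
    unfolding S_def using assms mult_mono[of 2 "real B" 2 "real B"]
    by (intro real_le_rsqrt) (simp add: power2_eq_square)
  then have "3 * 1 \<le> (S - 1) * (S - 3) + 3" by simp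
  moreover have "real (B mod 2) \<le> 1" by (cases "even B") (auto simp: odd_iff_mod_2_eq_one)
  ultimately have "4 * S \<le> S\<^sup>2 + 4 - real (B mod 2)"
    by (simp add: power2_eq_square algebra_simps)
  then show ?thesis
    unfolding gap_bound_def S2[symmetric] S_def[symmetric] using \<open>3 \<le> S\<close> by (simp add: field_simps)
qed

text \<open>\<open>B\<^sup>2 + 4 B\<close> is no square, as it lies strictly between
  \<open>(B + 1)\<^sup>2\<close> and \<open>(B + 2)\<^sup>2\<close>.\<close>

lemma extremal_irrational:
  assumes "B \<ge> 1"
  shows "extremal B \<notin> \<rat>"
proof
  assume "extremal B \<in> \<rat>"
  then have "real B + 2 * extremal B \<in> \<rat>" by simp
  then have "sqrt ((real B)\<^sup>2 + 4 * real B) \<in> \<rat>" by (simp add: sqrt_eq_extremal)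
  then obtain m n :: nat where n: "n \<noteq> 0"
    and mn: "\<bar>sqrt ((real B)\<^sup>2 + 4 * real B)\<bar> = real m / real n" and cop: "coprime m n"
    by (rule Rats_abs_nat_div_natE)
  have "(real m / real n)\<^sup>2 = real (B\<^sup>2 + 4 * B)"
    unfolding mn[symmetric] by simp
  then have "real (m\<^sup>2) = real ((B\<^sup>2 + 4 * B) * n\<^sup>2)"
    using n by (simp add: field_simps)
  then have eq: "m\<^sup>2 = (B\<^sup>2 + 4 * B) * n\<^sup>2" by (simp only: of_nat_eq_iff)
  then have "n\<^sup>2 dvd m\<^sup>2" by simp
  moreover have "coprime (n\<^sup>2) (m\<^sup>2)" using cop by (simp add: coprime_commute)
  ultimately have "n = 1" using coprime_common_divisor_nat[of "n\<^sup>2" "m\<^sup>2" "n\<^sup>2"] by simp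
  with eq have "m\<^sup>2 = B\<^sup>2 + 4 * B" by simp
  then have "(B + 1)\<^sup>2 < m\<^sup>2" "m\<^sup>2 < (B + 2)\<^sup>2"
    using assms by (simp_all add: power2_eq_square algebra_simps)
  then have "B + 1 < m" "m < B + 2" by (auto dest: power_less_imp_less_base)
  then show False by simp
qed

text \<open>The hypothesis \<open>w\<close> quantifies how far \<open>q'/q\<close> may be from its limiting value \<open>y\<close>; the summand
  \<open>- 2\<close> in \<open>N \<le> (j + 1) q + q' - 2\<close> makes up for it.\<close>

lemma scaled_gap_le:
  fixes \<alpha> A y q q' j :: real
  assumes "0 < q" "0 \<le> q'" "0 < y" "1 \<le> j" "j \<le> \<alpha>" "\<alpha> \<le> A"
    and w: "(q' - y * q - 2) * (\<alpha> + y) \<le> (j + 1 + y) * (q' - y * q)"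
  shows "((j + 1) * q + q' - 2) * (\<alpha> - j + 1) / (\<alpha> * q + q') \<le> (j + 1 + y) * (A - j + 1) / (A + y)"
proof -
  have pos: "0 < \<alpha> * q + q'" "0 < \<alpha> + y" "0 < A + y"
    using assms by (auto intro: add_pos_nonneg)
  \<comment> \<open>First the ratio \<open>q' / q\<close> is replaced by \<open>y\<close>. On
    substituting \<open>q' = y q + w\<close>, the terms in \<open>q\<close> cancel and hypothesis
    \<open>w\<close> remains.\<close>
  have "((j + 1) * q + q' - 2) * (\<alpha> + y) \<le> (j + 1 + y) * (\<alpha> * q + q')"
    using w by (simp add: algebra_simps)
  then have "((j + 1) * q + q' - 2) / (\<alpha> * q + q') \<le> (j + 1 + y) / (\<alpha> + y)"
    using pos by (simp add: divide_le_eq le_divide_eq mult.commute)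
  then have "((j + 1) * q + q' - 2) / (\<alpha> * q + q') * (\<alpha> - j + 1) \<le> (j + 1 + y) / (\<alpha> + y) * (\<alpha> - j + 1)"
    using assms by (intro mult_right_mono) auto
  also have "\<dots> = (j + 1 + y) * ((\<alpha> - j + 1) / (\<alpha> + y))" by simp
  also have "\<dots> \<le> (j + 1 + y) * ((A - j + 1) / (A + y))"
  proof (rule mult_left_mono)
    \<comment> \<open>Now \<alpha> is raised to \<open>A\<close>; the quotient is increasing because
      \<open>y + j - 1 \<ge> 0\<close>.\<close>
    have "0 \<le> (A - \<alpha>) * (y + j - 1)" using assms by simp
    then have "(\<alpha> - j + 1) * (A + y) \<le> (A - j + 1) * (\<alpha> + y)" by (simp add: algebra_simps)
    then show "(\<alpha> - j + 1) / (\<alpha> + y) \<le> (A - j + 1) / (A + y)"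
      using pos by (simp add: divide_le_eq le_divide_eq mult.commute)
  qed (use assms in simp)
  finally show ?thesis by simp
qed

text \<open>If \<open>\<alpha> < j + 1\<close>, the ratio of \<open>(j + 1) q + q'\<close> to
  \<open>\<alpha> q + q'\<close> decreases in \<open>q'\<close>, so a small \<open>q'\<close> cannot
  be compared with \<open>y q\<close> as before. Instead, twice the denominator minus the numerator
  splits into nonnegative terms.\<close>

lemma scaled_gap_le_2:
  fixes \<alpha> q q' j :: real
  assumes "0 < q" "0 \<le> q'" "1 \<le> j" "j \<le> \<alpha>" "\<alpha> \<le> j + 1"
  shows "((j + 1) * q + q' - 2) * (\<alpha> - j + 1) / (\<alpha> * q + q') \<le> 2"
proof -
  have "0 < \<alpha> * q + q'" using assms by (auto intro: add_pos_nonneg)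
  moreover have "((j + 1) * q + q' - 2) * (\<alpha> - j + 1) \<le> 2 * (\<alpha> * q + q')"
  proof -
    have "2 * (\<alpha> * q + q') - ((j + 1) * q + q' - 2) * (\<alpha> - j + 1) =
       q * ((j - 1) * (j + 1 - \<alpha>)) + q' * (j + 1 - \<alpha>) + 2 * (\<alpha> - j + 1)"
      by (simp add: algebra_simps)
    also have "\<dots> \<ge> 0" using assms by (intro add_nonneg_nonneg mult_nonneg_nonneg) auto
    finally show ?thesis by simp
  qed
  ultimately show ?thesis by (simp add: divide_le_eq)
qed

section \<open>Irrationals with digits at most B\<close>

locale bounded_digits = irrational +
  fixes B :: nat
  assumes digit_le: "a (Suc n) \<le> int B"
begin

abbreviation "y \<equiv> extremal B"

lemma B_ge_1: "B \<ge> 1"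
  using digit_pos[of 0] digit_le[of 0] by simp

text \<open>Two steps of the expansion bound every complete quotient by
  \<open>B + 1 / (1 + 1 / M)\<close>, where \<open>M\<close> is their supremum. So \<open>M\<close>
  obeys the same bound, that is \<open>M\<^sup>2 \<le> B M + B\<close>, and the positive root of
  this quadratic is \<open>B + y\<close>.\<close>

lemma complete_le: "\<alpha> (Suc n) \<le> real B + y"
proof -
  define M where "M = (SUP n. \<alpha> (Suc n))"
  have digit: "real_of_int (a (Suc n)) \<le> real B" for n
    using digit_le[of n] by (metis of_int_le_iff of_int_of_nat_eq)
  have "bdd_above (range (\<lambda>n. \<alpha> (Suc n)))"
  proof (rule bdd_aboveI2)
    show "\<alpha> (Suc n) \<le> real B + 1" for n
      using complete_less_digit[of "Suc n"] digit[of n] by linarith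
  qed
  then have le_M: "\<alpha> (Suc n) \<le> M" for n
    unfolding M_def by (rule cSUP_upper2[OF _ UNIV_I order_refl])
  have M1: "1 < M" using complete_gt_1[of 0] le_M[of 0] by linarith
  have "M \<le> real B + 1 / (1 + 1 / M)"
    unfolding M_def
  proof (rule cSUP_least)
    fix n
    have "1 / M \<le> 1 / \<alpha> (Suc (Suc (Suc n)))"
      using le_M[of "Suc (Suc n)"] complete_gt_1[of "Suc (Suc n)"] by (intro divide_left_mono) auto
    moreover have "1 \<le> real_of_int (a (Suc (Suc n)))" using digit_pos[of "Suc n"] by simp
    ultimately have "1 + 1 / M \<le> \<alpha> (Suc (Suc n))"
      using cf_complete_rec[of \<theta> "Suc (Suc n)"] by linarith
    then have "1 / \<alpha> (Suc (Suc n)) \<le> 1 / (1 + 1 / M)"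
      using M1 complete_gt_1[of "Suc n"] by (intro divide_left_mono) (auto intro!: mult_pos_pos add_pos_pos)
    then show "\<alpha> (Suc n) \<le> real B + 1 / (1 + 1 / (SUP n. \<alpha> (Suc n)))"
      using cf_complete_rec[of \<theta> "Suc n"] digit[of n] unfolding M_def[symmetric] by linarith
  qed simp
  also have "\<dots> = real B + M / (M + 1)" using M1 by (simp add: field_simps)
  finally have "M * (M + 1) \<le> real B * (M + 1) + M" using M1 by (simp add: field_simps)
  then have M2: "M\<^sup>2 \<le> real B * M + real B" by (simp add: power2_eq_square algebra_simps)
  have "M \<le> real B + y"
  proof (rule ccontr)
    assume "\<not> ?thesis"
    then have "0 < (M - (real B + y)) * (M + y)"
      using M1 extremal_pos[OF B_ge_1] by (intro mult_pos_pos) auto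
    also have "\<dots> = M\<^sup>2 - real B * M - (real B * y + y\<^sup>2)"
      by (simp add: power2_eq_square algebra_simps)
    finally show False using M2 by (simp add: extremal_quadratic algebra_simps)
  qed
  then show ?thesis using le_M[of n] by linarith
qed

text \<open>The error \<open>q\<^sub>n - y q\<^sub>n\<^sub>+\<^sub>1\<close> contracts by \<open>1 - y\<close> over two steps, with equality if the two digits
  involved are \<open>B\<close> and 1.\<close>

lemma den_diff_le: "real (q n) - y * real (q (Suc n)) \<le> 1"
proof (induction n rule: induct_nat_012)
  case 0
  show ?case using extremal_pos[OF B_ge_1] by simp
next
  case 1
  show ?case using extremal_pos[OF B_ge_1] by simp
next
  case (ge2 n)
  let ?u = "real (q n) - y * real (q (Suc n))"
  have y: "0 < y" "y < 1" using extremal_pos[OF B_ge_1] extremal_less_1 by auto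
  have 1: "1 \<le> real_of_int (a (Suc (Suc n)))" using digit_pos[of "Suc n"] by simp
  have 2: "real_of_int (a (Suc n)) \<le> real B"
    using digit_le[of n] by (metis of_int_le_iff of_int_of_nat_eq)
  have "real (q (Suc (Suc n))) - y * real (q (Suc (Suc (Suc n)))) =
      (1 - y * of_int (a (Suc (Suc n)))) * real (q (Suc (Suc n))) - y * real (q (Suc n))"
    unfolding den_rec[of "Suc n"] by (simp add: algebra_simps del: cf_den.simps)
  also have "\<dots> \<le> (1 - y) * real (q (Suc (Suc n))) - y * real (q (Suc n))"
    using 1 y by (intro diff_right_mono mult_right_mono) auto
  also have "\<dots> \<le> (1 - y) * (real B * real (q (Suc n)) + real (q n)) - y * real (q (Suc n))"
    unfolding den_rec[of n] using 2 y
    by (intro diff_right_mono mult_left_mono add_right_mono mult_right_mono) auto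
  also have "\<dots> = (1 - y) * ?u + (real B * (1 - y) - y\<^sup>2) * real (q (Suc n))"
    by (simp add: power2_eq_square algebra_simps)
  also have "\<dots> = (1 - y) * ?u" by (simp add: extremal_quadratic)
  also have "\<dots> \<le> (1 - y) * 1" using ge2 y by (intro mult_left_mono) auto
  finally show ?case using y by simp
qed

text \<open>All digits are 1. The upper bound \<open>complete_le\<close> for the next quotient gives
  the lower bound for this one. Since \<open>1 - y - y\<^sup>2 = 0\<close>, the error
  \<open>q n - y q (Suc n)\<close> is multiplied by \<open>- y\<close> in each step.\<close>

lemma golden_case:
  assumes "B = 1"
  shows "\<alpha> (Suc n) = 1 + y" "-1 \<le> real (q n) - y * real (q (Suc n))"
proof -
  have y: "0 < y" "y < 1" using extremal_pos[OF B_ge_1] extremal_less_1 by auto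
  have a1: "a (Suc n) = 1" for n using digit_pos[of n] digit_le[of n] assms by simp
  have yy: "y * y = 1 - y" using extremal_quadratic[of B] assms by (simp add: power2_eq_square)
  have "y * (1 + y) = 1" using yy by (simp add: algebra_simps)
  then have "y = 1 / (1 + y)" using y by (simp add: field_simps)
  also have "\<dots> \<le> 1 / \<alpha> (Suc (Suc n))"
    using complete_le[of "Suc n"] complete_gt_1[of "Suc n"] assms
    by (intro divide_left_mono) (auto intro: mult_pos_pos)
  finally show "\<alpha> (Suc n) = 1 + y"
    using complete_le[of n] cf_complete_rec[of \<theta> "Suc n"] a1[of n] assms by simp
  have "\<bar>real (q n) - y * real (q (Suc n))\<bar> \<le> 1"
  proof (induction n)
    case 0
    show ?case using y by simp
  next
    case (Suc n)
    have "real (q (Suc n)) - y * real (q (Suc (Suc n))) =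
       (1 - y - y * y) * real (q (Suc n)) - y * (real (q n) - y * real (q (Suc n)))"
      unfolding den_rec a1 by (simp add: algebra_simps)
    also have "\<dots> = - y * (real (q n) - y * real (q (Suc n)))" by (simp add: yy)
    finally have "\<bar>real (q (Suc n)) - y * real (q (Suc (Suc n)))\<bar> =
        y * \<bar>real (q n) - y * real (q (Suc n))\<bar>" using y by (simp add: abs_mult)
    also have "\<dots> \<le> 1 * 1" using Suc y by (intro mult_mono) auto
    finally show ?case by simp
  qed
  then show "-1 \<le> real (q n) - y * real (q (Suc n))" by linarith
qed

lemma scaled_max_gap_le: "real N * max_gap \<theta> N \<le> gap_bound B"
proof -
  obtain n j where j: "1 \<le> j" "int j \<le> a (Suc n)"
    and N: "j * q (Suc n) + q n \<le> N + 1" "N + 1 < (j + 1) * q (Suc n) + q n"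
    by (rule obtain_den_bounds[of N])
  define Q Q' \<beta> where "Q = real (q (Suc n))" and "Q' = real (q n)" and "\<beta> = \<alpha> (Suc n)"
  have y: "0 < y" "y < 1" using extremal_pos[OF B_ge_1] extremal_less_1 by auto
  have Q: "0 < Q" "0 \<le> Q'" using den_pos[of n] by (auto simp: Q_def Q'_def)
  have j': "1 \<le> real j" using j(1) by simp
  have "real j \<le> real_of_int (a (Suc n))" using j(2) by (metis of_int_le_iff of_int_of_nat_eq)
  then have j\<beta>: "real j \<le> \<beta>" using digit_le_complete[of "Suc n"] by (simp add: \<beta>_def)
  \<comment> \<open>Strictness over the integers gains one more unit; this is the source of the
    summand \<open>- 2\<close>.\<close>
  have "N + 2 \<le> (j + 1) * q (Suc n) + q n" using N(2) by simp
  then have "real (N + 2) \<le> real ((j + 1) * q (Suc n) + q n)" by (simp only: of_nat_le_iff)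
  then have NK: "real N \<le> (real j + 1) * Q + Q' - 2" by (simp add: Q_def Q'_def algebra_simps)
  have "real N * max_gap \<theta> N \<le> real N * ((\<beta> - real j + 1) * e (Suc n))"
    using max_gap_le_err[OF j N(1)] by (intro mult_left_mono) (auto simp: \<beta>_def)
  also have "\<dots> \<le> ((real j + 1) * Q + Q' - 2) * ((\<beta> - real j + 1) * e (Suc n))"
    using NK j\<beta> err_pos[of "Suc n"] by (intro mult_right_mono) auto
  also have "\<dots> = ((real j + 1) * Q + Q' - 2) * (\<beta> - real j + 1) / (\<beta> * Q + Q')"
    by (simp add: err_Suc_eq Q_def Q'_def \<beta>_def del: cf_den.simps)
  also have "\<dots> \<le> gap_bound B"
  proof (cases "B \<ge> 2 \<and> \<beta> < real j + 1")
    case True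
    then show ?thesis
      using scaled_gap_le_2[OF Q j' j\<beta>] gap_bound_ge_2[of B] by linarith
  next
    case False
    define w where "w = Q' - y * Q"
    have w1: "w \<le> 1" using den_diff_le[of n] by (simp add: w_def Q_def Q'_def)
    \<comment> \<open>For \<open>0 \<le> w \<le> 1\<close> the left side is nonpositive. For
      \<open>w < 0\<close> and \<open>B \<ge> 2\<close>, \<open>j + 1 \<le> \<beta>\<close>
      suffices. For \<open>B = 1\<close> this inequality fails, but \<open>-1 \<le> w\<close> gives
      \<open>w - 2 \<le> 3 w\<close>.\<close>
    have "(w - 2) * (\<beta> + y) \<le> (real j + 1 + y) * w"
    proof (cases "w \<ge> 0")
      case True
      then have "(w - 2) * (\<beta> + y) \<le> 0" "0 \<le> (real j + 1 + y) * w"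
        using w1 y j' j\<beta> by (auto simp: mult_le_0_iff)
      then show ?thesis by linarith
    next
      case neg: False
      show ?thesis
      proof (cases "B = 1")
        case True
        have "j = 1" using j digit_le[of n] True by simp
        have "\<beta> = 1 + y" "-1 \<le> w"
          using golden_case[OF True, of n] by (auto simp: \<beta>_def w_def Q_def Q'_def)
        then have "(w - 2) * (\<beta> + y) \<le> (3 * w) * (\<beta> + y)"
          using y by (intro mult_right_mono) auto
        also have "\<dots> = w * (3 + 6 * y)" using \<open>\<beta> = 1 + y\<close> by (simp add: algebra_simps)
        also have "\<dots> \<le> w * (2 + y)" using neg y by (intro mult_left_mono_neg) auto
        finally show ?thesis using \<open>j = 1\<close> by (simp add: algebra_simps)
      next
        case B: False
        then have "real j + 1 \<le> \<beta>" using False B_ge_1 by auto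
        then have "w * (\<beta> + y) \<le> w * (real j + 1 + y)"
          using neg by (intro mult_left_mono_neg) auto
        moreover have "0 \<le> 2 * (\<beta> + y)" using y j' j\<beta> by simp
        ultimately show ?thesis by (simp add: algebra_simps)
      qed
    qed
    then have "((real j + 1) * Q + Q' - 2) * (\<beta> - real j + 1) / (\<beta> * Q + Q')
       \<le> (real j + 1 + y) * (real B + y - real j + 1) / (real B + y + y)"
      unfolding w_def using Q y j' j\<beta> complete_le[of n]
      by (intro scaled_gap_le) (auto simp: \<beta>_def)
    also have "\<dots> = (real j + 1 + y) * (real B - real j + 1 + y) / (real B + 2 * y)"
      by (simp add: algebra_simps)
    also have "\<dots> \<le> gap_bound B" by (rule extremal_product_le_gap_bound[OF B_ge_1])
    finally show ?thesis .
  qed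
  finally show ?thesis .
qed

end

subsection \<open>The extremal number\<close>

text \<open>The quadratic equation read as one period of the continued fraction; the bounds identify
  the fractional part of \<open>1 / extremal B\<close>.\<close>

lemma inverse_extremal:
  assumes "B \<ge> 1"
  shows "1 / extremal B = 1 + 1 / (real B + extremal B)"
    and "0 < 1 / (real B + extremal B)" and "1 / (real B + extremal B) < 1"
proof -
  have "0 < extremal B" by (rule extremal_pos[OF assms])
  then show "1 / extremal B = 1 + 1 / (real B + extremal B)"
      "0 < 1 / (real B + extremal B)" "1 / (real B + extremal B) < 1"
    using extremal_quadratic[of B] assms by (auto simp: field_simps power2_eq_square)
qed

lemma cf_complete_extremal:
  assumes "B \<ge> 1"
  shows "cf_complete (extremal B) (Suc (2 * m)) = 1 / extremal B"
    and "cf_complete (extremal B) (Suc (Suc (2 * m))) = real B + extremal B"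
proof -
  let ?y = "extremal B"
  have y: "0 < ?y" "?y < 1" using extremal_pos[OF assms] extremal_less_1 by auto
  have "frac (1 / ?y) = 1 / (real B + ?y)"
    using inverse_extremal[OF assms] by (subst frac_unique_iff) auto
  then have step: "cf_complete ?y (Suc n) = 1 / ?y \<Longrightarrow> cf_complete ?y (Suc (Suc n)) = real B + ?y" for n
    by (simp add: cf_complete.simps(2))
  have frac2: "frac (real B + ?y) = ?y"
    using y by (subst frac_unique_iff) auto
  show *: "cf_complete ?y (Suc (2 * m)) = 1 / ?y"
  proof (induction m)
    case 0
    show ?case using y by (simp add: cf_complete.simps(2) frac_eq)
  next
    case (Suc m)
    have "cf_complete ?y (Suc (2 * Suc m)) = 1 / frac (cf_complete ?y (Suc (Suc (2 * m))))"
      by (simp add: cf_complete.simps(2))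
    then show ?case using step[OF Suc] frac2 by simp
  qed
  show "cf_complete ?y (Suc (Suc (2 * m))) = real B + ?y" by (rule step[OF *])
qed

lemma cf_digit_extremal:
  assumes "B \<ge> 1"
  shows "cf_digit (extremal B) (Suc (2 * m)) = 1"
    and "cf_digit (extremal B) (Suc (Suc (2 * m))) = int B"
proof -
  let ?y = "extremal B"
  have y: "0 < ?y" "?y < 1" using extremal_pos[OF assms] extremal_less_1 by auto
  show "cf_digit ?y (Suc (2 * m)) = 1"
    unfolding cf_digit_def cf_complete_extremal[OF assms] using inverse_extremal[OF assms]
    by (intro floor_unique) auto
  show "cf_digit ?y (Suc (Suc (2 * m))) = int B"
    unfolding cf_digit_def cf_complete_extremal[OF assms] using y by (intro floor_unique) auto
qed

lemma bounded_digits_extremal: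
  assumes "B \<ge> 1"
  shows "bounded_digits (extremal B) B"
proof
  show "extremal B \<notin> \<rat>" by (rule extremal_irrational[OF assms])
  show "cf_digit (extremal B) (Suc n) \<le> int B" for n
    using cf_digit_extremal[OF assms, of "n div 2"] assms
    by (cases "even n") (auto elim!: evenE oddE)
qed

text \<open>From an odd index the next two digits are \<open>B\<close> and 1, so both estimates in
  \<open>den_diff_le\<close> are equalities. Hence the ratio of the denominators tends to
  \<open>extremal B\<close>.\<close>

lemma extremal_den_diff:
  assumes "B \<ge> 1"
  shows "real (cf_den (extremal B) (Suc (2 * m))) - extremal B * real (cf_den (extremal B) (Suc (Suc (2 * m))))
    = (1 - extremal B) ^ Suc m"
proof -
  interpret bounded_digits "extremal B" B by (rule bounded_digits_extremal[OF assms])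
  show ?thesis
  proof (induction m)
    case 0
    show ?case using cf_digit_extremal(1)[OF assms, of 0] by simp
  next
    case (Suc m)
    let ?n = "Suc (2 * m)"
    have "real (q (Suc (Suc ?n))) - y * real (q (Suc (Suc (Suc ?n)))) =
       (1 - y) * (real B * real (q (Suc ?n)) + real (q ?n)) - y * real (q (Suc ?n))"
      unfolding den_rec[of "Suc ?n"] den_rec[of ?n]
      using cf_digit_extremal(1)[OF assms, of "Suc m"] cf_digit_extremal(2)[OF assms, of m]
      by (simp add: algebra_simps del: cf_den.simps)
    also have "\<dots> = (1 - y) * (real (q ?n) - y * real (q (Suc ?n)))
        + (real B * (1 - y) - y\<^sup>2) * real (q (Suc ?n))"
      by (simp add: power2_eq_square algebra_simps del: cf_den.simps)
    also have "\<dots> = (1 - y) ^ Suc (Suc m)"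
      unfolding Suc by (simp add: extremal_quadratic)
    finally show ?case by (simp del: cf_den.simps)
  qed
qed

text \<open>At odd indices the next complete quotient is exactly \<open>B + y\<close>. With the
  optimal \<open>j\<close> and the last \<open>N\<close> belonging to it, the scaled gaps are at
  least \<open>v m\<close>, which tends to the bound.\<close>

lemma gap_bound_le_sup:
  assumes B: "B \<ge> 1"
  shows "ereal (gap_bound B) \<le> (SUP N\<in>{1..}. ereal (real N * max_gap (extremal B) N))"
proof -
  interpret bounded_digits "extremal B" B by (rule bounded_digits_extremal[OF B])
  define j where "j = (B + 1) div 2"
  have j: "1 \<le> j" "j \<le> B" using B by (auto simp: j_def)
  have y: "0 < y" "y < 1" using extremal_pos[OF B] extremal_less_1 by auto
  define A where "A = real B + y"
  define Q u where "Q m = real (q (Suc (Suc (2 * m))))" and "u m = (1 - y) ^ Suc m" for m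
  have u: "0 \<le> u m" "u m \<le> 1" for m
    using y power_le_one[of "1 - y" "Suc m"] by (auto simp: u_def)
  have Q'_eq: "real (q (Suc (2 * m))) = y * Q m + u m" for m
    using extremal_den_diff[OF B, of m] by (simp add: Q_def u_def)
  have Q_pos: "0 < Q m" for m using den_pos[of "Suc (2 * m)"] by (simp add: Q_def del: cf_den.simps)
  have Q_ge: "real m \<le> Q m" for m
  proof -
    have "real (Suc (2 * m)) < real (q (Suc (Suc (2 * m))) + q (Suc (2 * m)))"
      using den_sum_ge[of "Suc (2 * m)"] by (simp only: of_nat_less_iff)
    then have "2 * real m + 1 < Q m + real (q (Suc (2 * m)))" by (simp add: Q_def del: cf_den.simps)
    also have "\<dots> \<le> Q m + (1 * Q m + 1)"
      unfolding Q'_eq using u[of m] y Q_pos[of m] by (intro add_mono mult_right_mono) auto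
    finally show ?thesis by simp
  qed
  have Q_lim: "filterlim Q at_top sequentially"
    by (rule filterlim_at_top_mono[OF filterlim_real_sequentially]) (simp add: Q_ge)
  \<comment> \<open>This is the scaled gap with numerator and denominator divided by
    \<open>Q m\<close>; the terms over \<open>Q m\<close> vanish in the limit.\<close>
  define v where "v m = (real j + 1 + y + (u m - 2) / Q m) * (A - real j + 1) / (A + y + u m / Q m)" for m
  have lim0: "(\<lambda>m. f m / Q m) \<longlonglongrightarrow> 0" if "\<And>m. \<bar>f m\<bar> \<le> 2" for f
  proof (rule Lim_null_comparison)
    show "\<forall>\<^sub>F m in sequentially. norm (f m / Q m) \<le> 2 / Q m"
      using divide_right_mono[OF that less_imp_le[OF Q_pos]] Q_pos by (simp add: abs_of_pos)
    show "(\<lambda>m. 2 / Q m) \<longlonglongrightarrow> 0"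
      using Q_lim by (rule real_tendsto_divide_at_top[OF tendsto_const])
  qed
  have "v \<longlonglongrightarrow> (real j + 1 + y + 0) * (A - real j + 1) / (A + y + 0)"
    unfolding v_def
  proof (intro tendsto_intros lim0)
    fix m
    show "\<bar>u m - 2\<bar> \<le> 2" "\<bar>u m\<bar> \<le> 2" using u[of m] by auto
    show "A + y + 0 \<noteq> 0" using y by (simp add: A_def)
  qed
  also have "(real j + 1 + y + 0) * (A - real j + 1) / (A + y + 0) = gap_bound B"
    using extremal_product_eq_gap_bound[OF B] by (simp add: j_def A_def algebra_simps)
  finally have "(\<lambda>m. ereal (v m)) \<longlonglongrightarrow> ereal (gap_bound B)" by simp
  then show ?thesis
  proof (rule LIMSEQ_le_const2, intro exI allI impI)
    fix m :: nat
    let ?n = "Suc (2 * m)"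
    define N where "N = (j + 1) * q (Suc ?n) + q ?n - 2"
    \<comment> \<open>The value 3 ensures that the natural subtraction in \<open>N\<close> does not
      truncate and that \<open>N \<ge> 1\<close>.\<close>
    have "2 * 1 + 1 \<le> (j + 1) * q (Suc ?n) + q ?n"
      using j(1) den_pos[of ?n] den_pos[of "2 * m"] by (intro add_mono mult_mono) (auto simp del: cf_den.simps)
    then have N: "N + 2 = (j + 1) * q (Suc ?n) + q ?n" and N1: "1 \<le> N"
      by (auto simp: N_def simp del: cf_den.simps)
    have dig: "int j \<le> a (Suc ?n)" using cf_digit_extremal(2)[OF B, of m] j by simp
    have "real (N + 2) = (real j + 1) * Q m + (y * Q m + u m)"
      unfolding N Q'_eq[symmetric] by (simp add: Q_def algebra_simps del: cf_den.simps)
    moreover have "Q m * (real j + 1 + y + (u m - 2) / Q m) = (real j + 1) * Q m + (y * Q m + u m) - 2"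
      using Q_pos[of m] by (simp add: field_simps)
    ultimately have N_eq: "real N = Q m * (real j + 1 + y + (u m - 2) / Q m)" by simp
    have "Q m * (A + y + u m / Q m) = A * Q m + (y * Q m + u m)"
      using Q_pos[of m] by (simp add: field_simps)
    then have e_eq: "e (Suc ?n) = 1 / (Q m * (A + y + u m / Q m))"
      unfolding err_Suc_eq cf_complete_extremal[OF B] Q'_eq by (simp only: Q_def A_def)
    have "v m = real N * ((A - real j + 1) * e (Suc ?n))"
      unfolding N_eq e_eq v_def using Q_pos[of m] by simp
    also have "\<dots> \<le> real N * max_gap (extremal B) N"
      using max_gap_ge_err[OF j(1) dig N] cf_complete_extremal(2)[OF B, of m]
      by (intro mult_left_mono) (auto simp: A_def)
    finally show "ereal (v m) \<le> (SUP N\<in>{1..}. ereal (real N * max_gap (extremal B) N))"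
      using N1 by (intro SUP_upper2[of N]) auto
  qed
qed

section \<open>The value of the supremum\<close>

lemma sup_scaled_gap_eq:
  assumes B: "B \<ge> 1"
  shows "sup_scaled_gap B = ereal (gap_bound B)"
proof (rule antisym)
  show "sup_scaled_gap B \<le> ereal (gap_bound B)"
    unfolding sup_scaled_gap_def
  proof (intro SUP_least)
    fix \<theta> N assume "\<theta> \<in> bounded_cf B"
    then interpret bounded_digits \<theta> B
      by unfold_locales (auto simp: bounded_cf_def intro: order_trans[OF abs_ge_self])
    show "ereal (real N * max_gap \<theta> N) \<le> ereal (gap_bound B)"
      using scaled_max_gap_le[of N] by simp
  qed
  interpret bounded_digits "extremal B" B by (rule bounded_digits_extremal[OF B])
  have "\<bar>a i\<bar> \<le> int B" if "i \<ge> 1" for i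
    using that digit_le[of "i - 1"] digit_pos[of "i - 1"] by simp
  then have "extremal B \<in> bounded_cf B" using irr by (simp add: bounded_cf_def)
  then show "ereal (gap_bound B) \<le> sup_scaled_gap B"
    unfolding sup_scaled_gap_def using gap_bound_le_sup[OF B] by (rule SUP_upper2)
qed

theorem theorem4:
  fixes B :: nat
  assumes "B \<ge> 1"
  shows "(\<forall>a::nat. B = 2 * a \<longrightarrow>
            sup_scaled_gap B =
              ereal (1 + (real a + 1)\<^sup>2 / (2 * sqrt ((real a)\<^sup>2 + 2 * real a)))) \<and>
         (\<forall>a::nat. B = 2 * a + 1 \<longrightarrow>
            sup_scaled_gap B =
              ereal (1 + ((real a)\<^sup>2 + 3 * real a + 2) / sqrt (4 * (real a)\<^sup>2 + 12 * real a + 5)))"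
proof (intro conjI allI impI)
  fix a :: nat assume a: "B = 2 * a"
  have "sqrt ((real B)\<^sup>2 + 4 * real B) = sqrt (4 * ((real a)\<^sup>2 + 2 * real a))"
    by (simp add: a power_mult_distrib)
  also have "\<dots> = 2 * sqrt ((real a)\<^sup>2 + 2 * real a)" by (simp only: real_sqrt_mult real_sqrt_four)
  finally have S: "sqrt ((real B)\<^sup>2 + 4 * real B) = 2 * sqrt ((real a)\<^sup>2 + 2 * real a)" .
  have "(real B)\<^sup>2 + 4 * real B + 4 - real (B mod 2) = 4 * (real a + 1)\<^sup>2"
    by (simp add: a power2_eq_square algebra_simps)
  then have "gap_bound B = 1 + (real a + 1)\<^sup>2 / (2 * sqrt ((real a)\<^sup>2 + 2 * real a))"
    unfolding gap_bound_def S by simp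
  then show "sup_scaled_gap B = ereal (1 + (real a + 1)\<^sup>2 / (2 * sqrt ((real a)\<^sup>2 + 2 * real a)))"
    using sup_scaled_gap_eq[OF assms] by simp
next
  fix a :: nat assume a: "B = 2 * a + 1"
  have S: "(real B)\<^sup>2 + 4 * real B = 4 * (real a)\<^sup>2 + 12 * real a + 5"
    by (simp add: a power2_eq_square algebra_simps)
  have num: "4 * (real a)\<^sup>2 + 12 * real a + 5 + 4 - real (B mod 2) = 4 * ((real a)\<^sup>2 + 3 * real a + 2)"
    by (simp add: a)
  have "gap_bound B = 1 + ((real a)\<^sup>2 + 3 * real a + 2) / sqrt (4 * (real a)\<^sup>2 + 12 * real a + 5)"
    unfolding gap_bound_def S num by (subst mult_divide_mult_cancel_left) simp_all
  then show "sup_scaled_gap B =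
      ereal (1 + ((real a)\<^sup>2 + 3 * real a + 2) / sqrt (4 * (real a)\<^sup>2 + 12 * real a + 5))"
    using sup_scaled_gap_eq[OF assms] by simp
qed

end
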